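(* Let $\mathfrak g$ be the centrally extended planar Galilean conformal algebra (in current form) and $\mathfrak g^*$ its regular dual, as defined in the context. Let $\xi,\eta_1,\eta_2$ be smooth real functions on $S^1$ and let $(\xi,\eta_1,\eta_2)$ denote the group element $\exp(J_\xi)\exp(P^1_{\eta_1}+P^2_{\eta_2})$. For $\vec\gamma={}^t(\gamma_0,\gamma_1,\gamma_2,\gamma_3,a,b)\in\mathfrak g^*$, the coadjoint action of $(\xi,\eta_1,\eta_2)$ leaves $a,b$ unchanged, and the first four components of $(\xi,\eta_1,\eta_2)(\vec\gamma)$ are $$\begin{pmatrix}\gamma_0+\sum_{k=1,2}(\gamma_k'\eta_k+2\gamma_k\eta_k')+(\gamma_1\eta_2-\gamma_2\eta_1+\gamma_3)\,\xi'+\frac b2(\xi')^2\\ \gamma_1\cos\xi+\gamma_2\sin\xi\\ -\gamma_1\sin\xi+\gamma_2\cos\xi\\ \gamma_1\eta_2-\gamma_2\eta_1+\gamma_3+b\,\xi'\end{pmatrix}.$$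
   Context: All functions are smooth real-valued functions on $S^1=\mathbb R/2\pi\mathbb Z$ with coordinate $\theta$; a prime denotes $d/d\theta$. The centerless algebra $\mathfrak g_0$ is the Lie algebra of vector fields spanned by $L_f=f(\theta)\partial_\theta+f'(\theta)\sum_{i=1,2}x_i\partial_{x_i}$, $J_f=f(\theta)(x_1\partial_{x_2}-x_2\partial_{x_1})$, $P^i_f=f(\theta)\partial_{x_i}$ ($i=1,2$), $f\in C^\infty(S^1)$. Its brackets are $$[L_f,L_g]=L_{fg'-f'g},\quad [L_f,P^i_g]=P^i_{fg'-f'g},\quad [L_f,J_g]=J_{fg'},$$ $$[J_f,P^i_g]=-\sum_{k=1,2}\epsilon_{ik}P^k_{fg},\quad [J_f,J_g]=[P^i_f,P^j_g]=0,$$ with $\epsilon_{12}=-\epsilon_{21}=1$, $\epsilon_{11}=\epsilon_{22}=0$. The algebra $\mathfrak g=\mathfrak g_0\oplus\mathbb R\oplus\mathbb R$ is the two-dimensional central extension with central elements $C_1,C_2$ whose brackets are those above except for $$[L_f,L_g]=L_{fg'-f'g}-\Big(\int_{S^1}f'''g\,d\theta\Big)C_1,\qquad [J_f,J_g]=\Big(\int_{S^1}f g'\,d\theta\Big)C_2 .$$ An element of $\mathfrak g$ is $X=L_{f_0}+P^1_{f_1}+P^2_{f_2}+J_{f_3}+\alpha C_1+\beta C_2$ with $\alpha,\beta\in\mathbb R$. The regular dual $\mathfrak g^*$ consists of vectors $\vec\gamma={}^t(\gamma_0,\gamma_1,\gamma_2,\gamma_3,a,b)$ with $\gamma_i\in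 C^\infty(S^1)$, $a,b\in\mathbb R$ (standing for $\gamma_0d\theta^2+\gamma_1d\theta^2+\gamma_2d\theta^2+\gamma_3d\theta+a+b$), paired with $\mathfrak g$ by $$\langle\vec\gamma,X\rangle=\sum_{i=0}^3\int_{S^1}\gamma_i f_i\,d\theta+a\alpha+b\beta .$$ For $g=(\xi,\eta_1,\eta_2)=\exp(J_\xi)\exp(P^1_{\eta_1}+P^2_{\eta_2})$, the adjoint action of $g^{-1}$ on $X\in\mathfrak g$ is $$g^{-1}Xg=\exp\!\big(-\mathrm{ad}(P^1_{\eta_1}+P^2_{\eta_2})\big)\,\exp\!\big(-\mathrm{ad}(J_\xi)\big)\,X,$$ where $\mathrm{ad}(Y)Z=[Y,Z]$ is the bracket in $\mathfrak g$ and the exponentials are the usual exponential series (which converge on $\mathfrak g$). The coadjoint action of $g$ on $\gamma\in\mathfrak g^*$ is the element $g(\gamma)\in\mathfrak g^*$ determined by $\langle g(\gamma),X\rangle=\langle\gamma,g^{-1}Xg\rangle$ for all $X\in\mathfrak g$. *)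

theory Defs
  imports "HOL-Analysis.Analysis"
begin

section \<open>Smooth functions on the circle\<close>

definition smooth :: "(real \<Rightarrow> real) \<Rightarrow> bool" where
  "smooth f \<longleftrightarrow> (\<forall>n x. ((deriv ^^ n) f) differentiable (at x))"

definition diffn :: "nat \<Rightarrow> (real \<Rightarrow> real) \<Rightarrow> bool" where
  "diffn n f \<longleftrightarrow> (\<forall>k<n. \<forall>x. ((deriv ^^ k) f) differentiable (at x))"

lemma smooth_iff_diffn: "smooth f \<longleftrightarrow> (\<forall>n. diffn n f)"
  unfolding smooth_def diffn_def by blast

lemma diffn_0 [simp]: "diffn 0 f"
  by (simp add: diffn_def)

lemma diffn_Suc: "diffn (Suc n) f \<longleftrightarrow> (\<forall>x. f differentiable (at x)) \<and> diffn n (deriv f)"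
  unfolding diffn_def
  by (simp add: less_Suc_eq_0_disj all_conj_distrib funpow_swap1 imp_disjL del: funpow.simps)
     (auto simp: funpow_Suc_right simp del: funpow.simps)

lemma diffn_mono: "diffn n f \<Longrightarrow> m \<le> n \<Longrightarrow> diffn m f"
  unfolding diffn_def by auto

lemma diffn_SucD: "diffn (Suc n) f \<Longrightarrow> diffn n f"
  by (rule diffn_mono) auto

lemma DERIV_deriv_if_differentiable:
  "f differentiable (at x) \<Longrightarrow> (f has_real_derivative deriv f x) (at x)" for f :: "real \<Rightarrow> real"
  using DERIV_deriv_iff_real_differentiable by blast

lemma diffn_const: "diffn n (\<lambda>x. c)"
proof (induction n arbitrary: c)
  case (Suc n)
  have "deriv (\<lambda>x::real. c) = (\<lambda>x. 0)" by auto
  then show ?case using Suc[of 0] by (simp add: diffn_Suc)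
qed simp

lemma diffn_add: "diffn n f \<Longrightarrow> diffn n g \<Longrightarrow> diffn n (\<lambda>x. f x + g x)"
proof (induction n arbitrary: f g)
  case (Suc n)
  then have "deriv (\<lambda>x. f x + g x) = (\<lambda>x. deriv f x + deriv g x)"
    by (intro ext DERIV_imp_deriv DERIV_add DERIV_deriv_if_differentiable) (auto simp: diffn_Suc)
  with Suc show ?case by (auto simp: diffn_Suc)
qed simp

lemma diffn_mult: "diffn n f \<Longrightarrow> diffn n g \<Longrightarrow> diffn n (\<lambda>x. f x * g x)"
proof (induction n arbitrary: f g)
  case (Suc n)
  then have "deriv (\<lambda>x. f x * g x) = (\<lambda>x. deriv f x * g x + f x * deriv g x)"
    by (intro ext DERIV_imp_deriv)
       (auto simp: diffn_Suc intro!: derivative_eq_intros DERIV_deriv_if_differentiable)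
  moreover have "diffn n (\<lambda>x. deriv f x * g x + f x * deriv g x)"
    using Suc.prems diffn_SucD
    by (intro diffn_add Suc.IH) (auto simp: diffn_Suc[of n f] diffn_Suc[of n g])
  ultimately show ?case using Suc.prems by (auto simp: diffn_Suc)
qed simp

lemma diffn_cos_sin:
  "diffn n f \<Longrightarrow> diffn n (\<lambda>x. cos (f x)) \<and> diffn n (\<lambda>x. sin (f x))"
proof (induction n arbitrary: f)
  case (Suc n)
  have D: "(f has_real_derivative deriv f x) (at x)" for x
    using Suc.prems by (auto intro: DERIV_deriv_if_differentiable simp: diffn_Suc)
  have c: "((\<lambda>x. cos (f x)) has_real_derivative (- 1 * sin (f x)) * deriv f x) (at x)"
   and s: "((\<lambda>x. sin (f x)) has_real_derivative cos (f x) * deriv f x) (at x)" for x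
    by (auto intro!: derivative_eq_intros D)
  have "deriv (\<lambda>x. cos (f x)) = (\<lambda>x. (- 1 * sin (f x)) * deriv f x)"
       "deriv (\<lambda>x. sin (f x)) = (\<lambda>x. cos (f x) * deriv f x)"
    using c s by (auto intro!: ext DERIV_imp_deriv)
  moreover have "diffn n f" "diffn n (deriv f)"
    using Suc.prems diffn_SucD by (auto simp: diffn_Suc[of n f])
  moreover have "diffn n (\<lambda>x. (- 1 * sin (f x)) * deriv f x)"
    "diffn n (\<lambda>x. cos (f x) * deriv f x)"
    using Suc.IH[of f] calculation by (auto intro!: diffn_mult diffn_const simp only:)
  ultimately show ?case using c s
    unfolding diffn_Suc real_differentiable_def by metis
qed simp

lemma smooth_const: "smooth (\<lambda>x. c)"
  and smooth_add: "smooth f \<Longrightarrow> smooth g \<Longrightarrow> smooth (\<lambda>x. f x + g x)"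
  and smooth_mult: "smooth f \<Longrightarrow> smooth g \<Longrightarrow> smooth (\<lambda>x. f x * g x)"
  and smooth_cos: "smooth f \<Longrightarrow> smooth (\<lambda>x. cos (f x))"
  and smooth_sin: "smooth f \<Longrightarrow> smooth (\<lambda>x. sin (f x))"
  using diffn_const diffn_add diffn_mult diffn_cos_sin by (auto simp: smooth_iff_diffn)

lemma smooth_uminus: "smooth f \<Longrightarrow> smooth (\<lambda>x. - f x)"
  using smooth_mult[OF smooth_const[of "-1"]] by simp

lemma smooth_diff: "smooth f \<Longrightarrow> smooth g \<Longrightarrow> smooth (\<lambda>x. f x - g x)"
  using smooth_add[OF _ smooth_uminus] by simp

lemma smooth_deriv: "smooth f \<Longrightarrow> smooth (deriv f)"
  unfolding smooth_iff_diffn using diffn_Suc by blast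

lemma smooth_differentiable: "smooth f \<Longrightarrow> f differentiable (at x)"
  unfolding smooth_iff_diffn using diffn_Suc by blast

lemma deriv_periodic:
  fixes f :: "real \<Rightarrow> real"
  assumes "\<And>x. f (x + p) = f x"
  shows "deriv f (x + p) = deriv f x"
proof -
  have "(f has_real_derivative D) (at (x + p)) \<longleftrightarrow> (f has_real_derivative D) (at x)" for D
    using DERIV_shift[of f D x p] assms by simp
  then show ?thesis by (simp add: deriv_def)
qed

text \<open>
  A smooth function on \<open>\<real> / 2\<pi>\<int>\<close> is identified with its \<open>2\<pi>\<close>-periodic lift to \<open>\<real>\<close>.
\<close>

typedef circle_fun = "{f :: real \<Rightarrow> real. smooth f \<and> (\<forall>x. f (x + 2 * pi) = f x)}"
  morphisms eval Circle_fun
  by (rule exI[of _ "\<lambda>x. 0"]) (simp add: smooth_const)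

setup_lifting type_definition_circle_fun

instantiation circle_fun :: comm_ring_1
begin
lift_definition zero_circle_fun :: circle_fun is "\<lambda>x. 0"
  by (simp add: smooth_const)
lift_definition one_circle_fun :: circle_fun is "\<lambda>x. 1"
  by (simp add: smooth_const)
lift_definition plus_circle_fun :: "circle_fun \<Rightarrow> circle_fun \<Rightarrow> circle_fun" is "\<lambda>f g x. f x + g x"
  by (simp add: smooth_add)
lift_definition uminus_circle_fun :: "circle_fun \<Rightarrow> circle_fun" is "\<lambda>f x. - f x"
  by (simp add: smooth_uminus)
lift_definition minus_circle_fun :: "circle_fun \<Rightarrow> circle_fun \<Rightarrow> circle_fun" is "\<lambda>f g x. f x - g x"
  by (simp add: smooth_diff)
lift_definition times_circle_fun :: "circle_fun \<Rightarrow> circle_fun \<Rightarrow> circle_fun" is "\<lambda>f g x. f x * g x"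
  by (simp add: smooth_mult)
instance
  by standard (transfer, auto simp: fun_eq_iff algebra_simps)+
end

instantiation circle_fun :: real_algebra_1
begin
lift_definition scaleR_circle_fun :: "real \<Rightarrow> circle_fun \<Rightarrow> circle_fun" is "\<lambda>c f x. c * f x"
  by (simp add: smooth_mult smooth_const)
instance
  by standard (transfer, auto simp: fun_eq_iff algebra_simps)+
end

lift_definition diff_circle :: "circle_fun \<Rightarrow> circle_fun"  (\<open>\<partial>\<close>) is deriv
  by (simp add: smooth_deriv deriv_periodic)

lift_definition cos_circle :: "circle_fun \<Rightarrow> circle_fun" is "\<lambda>f x. cos (f x)"
  by (simp add: smooth_cos)

lift_definition sin_circle :: "circle_fun \<Rightarrow> circle_fun" is "\<lambda>f x. sin (f x)"
  by (simp add: smooth_sin)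

lift_definition integral_circle :: "circle_fun \<Rightarrow> real" is "\<lambda>f. integral {0..2 * pi} f" .

lemma eval_simps [simp]:
  "eval 0 x = 0" "eval 1 x = 1" "eval (f + g) x = eval f x + eval g x"
  "eval (- f) x = - eval f x" "eval (f - g) x = eval f x - eval g x"
  "eval (f * g) x = eval f x * eval g x" "eval (c *\<^sub>R f) x = c * eval f x"
  by (transfer, simp)+

lemma eval_DERIV: "(eval f has_real_derivative eval (\<partial> f) x) (at x)"
  by transfer (auto intro: DERIV_deriv_if_differentiable smooth_differentiable)

lemma circle_fun_eqI: "(\<And>x. eval f x = eval g x) \<Longrightarrow> f = g"
  by transfer auto

lemma diff_circle_add: "\<partial> (f + g) = \<partial> f + \<partial> g"
  by (rule circle_fun_eqI, rule DERIV_unique[OF eval_DERIV])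
     (auto simp: plus_circle_fun.rep_eq intro!: derivative_eq_intros eval_DERIV)

lemma diff_circle_scaleR: "\<partial> (c *\<^sub>R f) = c *\<^sub>R \<partial> f"
  by (rule circle_fun_eqI, rule DERIV_unique[OF eval_DERIV])
     (auto simp: scaleR_circle_fun.rep_eq intro!: derivative_eq_intros eval_DERIV)

lemma diff_circle_mult: "\<partial> (f * g) = \<partial> f * g + f * \<partial> g"
  by (rule circle_fun_eqI, rule DERIV_unique[OF eval_DERIV])
     (auto simp: times_circle_fun.rep_eq intro!: derivative_eq_intros eval_DERIV)

lemma diff_circle_0 [simp]: "\<partial> 0 = 0"
  using diff_circle_scaleR[of 0 0] by simp

lemma diff_circle_uminus: "\<partial> (- f) = - \<partial> f"
  using diff_circle_scaleR[of "-1" f] by simp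

lemma diff_circle_diff: "\<partial> (f - g) = \<partial> f - \<partial> g"
  using diff_circle_add[of f "- g"] by (simp add: diff_circle_uminus)

lemma eval_integrable: "eval f integrable_on {a..b}"
  by (intro integrable_continuous_real continuous_at_imp_continuous_on ballI DERIV_isCont[OF eval_DERIV])

lemma integral_circle_add: "integral_circle (f + g) = integral_circle f + integral_circle g"
  by (simp add: integral_circle.rep_eq plus_circle_fun.rep_eq integral_add eval_integrable)

lemma integral_circle_scaleR: "integral_circle (c *\<^sub>R f) = c * integral_circle f"
  by (simp add: integral_circle.rep_eq scaleR_circle_fun.rep_eq)

lemma integral_circle_0 [simp]: "integral_circle 0 = 0"
  using integral_circle_scaleR[of 0 0] by simp

lemma integral_circle_uminus: "integral_circle (- f) = - integral_circle f"
  using integral_circle_scaleR[of "-1" f] by simp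

lemma integral_circle_diff_circle: "integral_circle (\<partial> f) = 0"
proof -
  have "(eval (\<partial> f) has_integral eval f (2 * pi) - eval f 0) {0..2 * pi}"
    using eval_DERIV[of f]
    by (intro fundamental_theorem_of_calculus)
       (auto simp: has_real_derivative_iff_has_vector_derivative[symmetric]
             intro: has_field_derivative_at_within)
  moreover have "eval f (2 * pi) = eval f 0"
    by (transfer, metis add_0)
  ultimately show ?thesis
    by (simp add: integral_circle.rep_eq integral_unique)
qed

text \<open>
  The Frechet topology of \<open>C\<^sup>\<infinity>(S\<^sup>1)\<close>: uniform convergence of the function and of all its
  derivatives.
\<close>

instantiation circle_fun :: t2_space
begin
definition open_circle_fun :: "circle_fun set \<Rightarrow> bool" where
  "open_circle_fun U \<longleftrightarrow>
     (\<forall>f\<in>U. \<exists>n. \<exists>e>0. \<forall>g. (\<forall>k\<le>n. \<forall>x. \<bar>eval ((\<partial> ^^ k) (g - f)) x\<bar> < e) \<longrightarrow> g \<in> U)"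
instance
proof
  show "open (UNIV :: circle_fun set)"
    unfolding open_circle_fun_def by (auto intro: exI[of _ 1])
next
  fix S T :: "circle_fun set"
  assume S: "open S" and T: "open T"
  show "open (S \<inter> T)"
    unfolding open_circle_fun_def
  proof
    fix f assume f: "f \<in> S \<inter> T"
    obtain n e where S': "e > 0" "\<And>g. (\<forall>k\<le>n. \<forall>x. \<bar>eval ((\<partial> ^^ k) (g - f)) x\<bar> < e) \<Longrightarrow> g \<in> S"
      using S f unfolding open_circle_fun_def by blast
    obtain m d where T': "d > 0" "\<And>g. (\<forall>k\<le>m. \<forall>x. \<bar>eval ((\<partial> ^^ k) (g - f)) x\<bar> < d) \<Longrightarrow> g \<in> T"
      using T f unfolding open_circle_fun_def by blast
    show "\<exists>n. \<exists>e>0. \<forall>g. (\<forall>k\<le>n. \<forall>x. \<bar>eval ((\<partial> ^^ k) (g - f)) x\<bar> < e) \<longrightarrow> g \<in> S \<inter> T"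
      by (rule exI[of _ "max n m"], rule exI[of _ "min e d"]) (auto simp: S' T')
  qed
next
  fix K :: "circle_fun set set"
  assume "\<forall>S\<in>K. open S"
  then show "open (\<Union>K)"
    unfolding open_circle_fun_def by (meson UnionE UnionI)
next
  fix f g :: circle_fun
  assume "f \<noteq> g"
  then obtain x where x: "eval f x \<noteq> eval g x"
    using circle_fun_eqI by blast
  define e where "e = \<bar>eval f x - eval g x\<bar> / 2"
  have "open {h. \<bar>eval h x - eval u x\<bar> < e}" for u
    unfolding open_circle_fun_def
  proof
    fix v assume "v \<in> {h. \<bar>eval h x - eval u x\<bar> < e}"
    then have v: "\<bar>eval v x - eval u x\<bar> < e" by simp
    have "\<bar>eval h x - eval u x\<bar> < e" if "\<bar>eval (h - v) x\<bar> < e - \<bar>eval v x - eval u x\<bar>" for h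
      using that by simp
    with v show "\<exists>n. \<exists>d>0. \<forall>h. (\<forall>k\<le>n. \<forall>x. \<bar>eval ((\<partial> ^^ k) (h - v)) x\<bar> < d) \<longrightarrow>
        h \<in> {h. \<bar>eval h x - eval u x\<bar> < e}"
      by (intro exI[of _ 0] exI[of _ "e - \<bar>eval v x - eval u x\<bar>"]) auto
  qed
  moreover have "e > 0" using x by (simp add: e_def)
  moreover have "{h. \<bar>eval h x - eval f x\<bar> < e} \<inter> {h. \<bar>eval h x - eval g x\<bar> < e} = {}"
  proof -
    have False if "\<bar>eval h x - eval f x\<bar> < e" "\<bar>eval h x - eval g x\<bar> < e" for h
      using that unfolding e_def by argo
    then show ?thesis by blast
  qed
  ultimately show "\<exists>U V. open U \<and> open V \<and> f \<in> U \<and> g \<in> V \<and> U \<inter> V = {}"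
    by (intro exI[of _ "{h. \<bar>eval h x - eval f x\<bar> < e}"] exI[of _ "{h. \<bar>eval h x - eval g x\<bar> < e}"]) auto
qed
end

section \<open>The centrally extended planar Galilean conformal algebra\<close>

text \<open>
  The tuple \<open>(f0, f1, f2, f3, \<alpha>, \<beta>)\<close> stands for
  \<open>L\<^bsub>f0\<^esub> + P\<^sup>1\<^bsub>f1\<^esub> + P\<^sup>2\<^bsub>f2\<^esub> + J\<^bsub>f3\<^esub> + \<alpha> C\<^sub>1 + \<beta> C\<^sub>2\<close>.
  Vector space structure and topology are those of the product.
\<close>

type_synonym gca = "circle_fun \<times> circle_fun \<times> circle_fun \<times> circle_fun \<times> real \<times> real"

definition gen_L :: "circle_fun \<Rightarrow> gca" where "gen_L f = (f, 0, 0, 0, 0, 0)"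
definition gen_P1 :: "circle_fun \<Rightarrow> gca" where "gen_P1 f = (0, f, 0, 0, 0, 0)"
definition gen_P2 :: "circle_fun \<Rightarrow> gca" where "gen_P2 f = (0, 0, f, 0, 0, 0)"
definition gen_J :: "circle_fun \<Rightarrow> gca" where "gen_J f = (0, 0, 0, f, 0, 0)"
definition gen_C1 :: gca where "gen_C1 = (0, 0, 0, 0, 1, 0)"
definition gen_C2 :: gca where "gen_C2 = (0, 0, 0, 0, 0, 1)"

text \<open>
  The bilinear antisymmetric extension of the brackets of the generators; the lemmas below
  check that it is bilinear, alternating, satisfies the Jacobi identity, and takes the required
  values on generators.
\<close>

fun bracket :: "gca \<Rightarrow> gca \<Rightarrow> gca" where
  "bracket (f0, f1, f2, f3, \<alpha>, \<beta>) (g0, g1, g2, g3, \<alpha>', \<beta>') =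
    (f0 * \<partial> g0 - \<partial> f0 * g0,
     (f0 * \<partial> g1 - \<partial> f0 * g1) - (g0 * \<partial> f1 - \<partial> g0 * f1) + (f3 * g2 - g3 * f2),
     (f0 * \<partial> g2 - \<partial> f0 * g2) - (g0 * \<partial> f2 - \<partial> g0 * f2) - (f3 * g1 - g3 * f1),
     f0 * \<partial> g3 - g0 * \<partial> f3,
     - integral_circle (\<partial> (\<partial> (\<partial> f0)) * g0),
     integral_circle (f3 * \<partial> g3))"

lemmas gen_defs = gen_L_def gen_P1_def gen_P2_def gen_J_def gen_C1_def gen_C2_def

lemma gca_decompose:
  "(f0, f1, f2, f3, \<alpha>, \<beta>) =
     gen_L f0 + gen_P1 f1 + gen_P2 f2 + gen_J f3 + \<alpha> *\<^sub>R gen_C1 + \<beta> *\<^sub>R gen_C2"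
  by (simp add: gen_defs)

lemma bracket_generators:
  "bracket (gen_L f) (gen_L g) =
     gen_L (f * \<partial> g - \<partial> f * g) - integral_circle (\<partial> (\<partial> (\<partial> f)) * g) *\<^sub>R gen_C1"
  "bracket (gen_L f) (gen_P1 g) = gen_P1 (f * \<partial> g - \<partial> f * g)"
  "bracket (gen_L f) (gen_P2 g) = gen_P2 (f * \<partial> g - \<partial> f * g)"
  "bracket (gen_L f) (gen_J g) = gen_J (f * \<partial> g)"
  "bracket (gen_J f) (gen_P1 g) = - gen_P2 (f * g)"
  "bracket (gen_J f) (gen_P2 g) = gen_P1 (f * g)"
  "bracket (gen_J f) (gen_J g) = integral_circle (f * \<partial> g) *\<^sub>R gen_C2"
  "bracket (gen_P1 f) (gen_P1 g) = 0"
  "bracket (gen_P1 f) (gen_P2 g) = 0"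
  "bracket (gen_P2 f) (gen_P2 g) = 0"
  "bracket gen_C1 X = 0"
  "bracket gen_C2 X = 0"
  by (simp_all add: gen_defs zero_prod_def, (cases X, simp)+)

lemma bracket_add_left: "bracket (X + X') Y = bracket X Y + bracket X' Y"
  by (cases X; cases X'; cases Y)
     (simp add: diff_circle_add integral_circle_add algebra_simps)

lemma bracket_scaleR_left: "bracket (c *\<^sub>R X) Y = c *\<^sub>R bracket X Y"
  by (cases X; cases Y)
     (simp add: diff_circle_scaleR integral_circle_scaleR algebra_simps)

lemma bracket_antisym: "bracket Y X = - bracket X Y"
proof -
  have 1: "integral_circle (\<partial> (\<partial> (\<partial> g)) * f) = - integral_circle (\<partial> (\<partial> (\<partial> f)) * g)" for f g
    using integral_circle_diff_circle[of "\<partial> (\<partial> f) * g - \<partial> f * \<partial> g + f * \<partial> (\<partial> g)"]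
    by (simp add: diff_circle_add diff_circle_diff diff_circle_mult integral_circle_add
          algebra_simps eq_neg_iff_add_eq_0)
  have 2: "integral_circle (g * \<partial> f) = - integral_circle (f * \<partial> g)" for f g
    using integral_circle_diff_circle[of "f * g"]
    by (simp add: diff_circle_mult integral_circle_add algebra_simps eq_neg_iff_add_eq_0)
  show ?thesis
  proof (cases X; cases Y)
    fix f0 f1 f2 f3 a b g0 g1 g2 g3 c d
    assume XY: "X = (f0, f1, f2, f3, a, b)" "Y = (g0, g1, g2, g3, c, d)"
    show ?thesis
      unfolding XY using 1[of g0 f0] 2[of g3 f3] by (simp add: algebra_simps)
  qed
qed

lemma bracket_Jacobi:
  "bracket X (bracket Y Z) + bracket Y (bracket Z X) + bracket Z (bracket X Y) = 0"
proof (cases X; cases Y; cases Z)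
  fix f0 f1 f2 f3 a b g0 g1 g2 g3 c d h0 h1 h2 h3 r s
  assume XYZ: "X = (f0, f1, f2, f3, a, b)" "Y = (g0, g1, g2, g3, c, d)" "Z = (h0, h1, h2, h3, r, s)"
  have C1: "integral_circle (\<partial> (\<partial> (\<partial> f0)) * (g0 * \<partial> h0 - \<partial> g0 * h0))
      + integral_circle (\<partial> (\<partial> (\<partial> g0)) * (h0 * \<partial> f0 - \<partial> h0 * f0))
      + integral_circle (\<partial> (\<partial> (\<partial> h0)) * (f0 * \<partial> g0 - \<partial> f0 * g0)) = 0"
    using integral_circle_diff_circle[of "\<partial> (\<partial> f0) * (g0 * \<partial> h0 - \<partial> g0 * h0)
      + \<partial> (\<partial> g0) * (h0 * \<partial> f0 - \<partial> h0 * f0) + \<partial> (\<partial> h0) * (f0 * \<partial> g0 - \<partial> f0 * g0)"]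
    unfolding integral_circle_add[symmetric]
    by (simp add: diff_circle_add diff_circle_diff diff_circle_mult algebra_simps)
  have C2: "integral_circle (f3 * \<partial> (g0 * \<partial> h3 - h0 * \<partial> g3))
      + integral_circle (g3 * \<partial> (h0 * \<partial> f3 - f0 * \<partial> h3))
      + integral_circle (h3 * \<partial> (f0 * \<partial> g3 - g0 * \<partial> f3)) = 0"
    using integral_circle_diff_circle[of "f3 * (g0 * \<partial> h3 - h0 * \<partial> g3)
      + g3 * (h0 * \<partial> f3 - f0 * \<partial> h3) + h3 * (f0 * \<partial> g3 - g0 * \<partial> f3)"]
    unfolding integral_circle_add[symmetric]
    by (simp add: diff_circle_add diff_circle_diff diff_circle_mult algebra_simps)
  show ?thesis
    unfolding XYZ bracket.simps add_Pair zero_prod_def prod.inject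
    using C1 C2
    by (intro conjI)
       (simp_all add: diff_circle_add diff_circle_diff diff_circle_mult algebra_simps
          del: integral_circle_0)
qed

section \<open>Coadjoint action on the regular dual\<close>

text \<open>
  The tuple \<open>(\<gamma>0, \<gamma>1, \<gamma>2, \<gamma>3, a, b)\<close> stands for
  \<open>\<gamma>0 d\<theta>\<^sup>2 + \<gamma>1 d\<theta>\<^sup>2 + \<gamma>2 d\<theta>\<^sup>2 + \<gamma>3 d\<theta> + a + b\<close>.
\<close>

type_synonym gca_dual = "circle_fun \<times> circle_fun \<times> circle_fun \<times> circle_fun \<times> real \<times> real"

fun pairing :: "gca_dual \<Rightarrow> gca \<Rightarrow> real" where
  "pairing (\<gamma>0, \<gamma>1, \<gamma>2, \<gamma>3, a, b) (f0, f1, f2, f3, \<alpha>, \<beta>) =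
     integral_circle (\<gamma>0 * f0) + integral_circle (\<gamma>1 * f1) + integral_circle (\<gamma>2 * f2)
       + integral_circle (\<gamma>3 * f3) + a * \<alpha> + b * \<beta>"

definition exp_op :: "(gca \<Rightarrow> gca) \<Rightarrow> gca \<Rightarrow> gca" where
  "exp_op T X = (\<Sum>n. (1 / fact n) *\<^sub>R (T ^^ n) X)"

text \<open>
  A triple \<open>(\<xi>, \<eta>1, \<eta>2)\<close> stands for the group element \<open>exp(J\<^bsub>\<xi>\<^esub>) exp(P\<^sup>1\<^bsub>\<eta>1\<^esub> + P\<^sup>2\<^bsub>\<eta>2\<^esub>)\<close>, which enters
  only through the adjoint action of its inverse.
\<close>

type_synonym gca_group = "circle_fun \<times> circle_fun \<times> circle_fun"

fun Ad_inverse :: "gca_group \<Rightarrow> gca \<Rightarrow> gca" where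
  "Ad_inverse (\<xi>, \<eta>1, \<eta>2) X =
     exp_op (\<lambda>Z. - bracket (gen_P1 \<eta>1 + gen_P2 \<eta>2) Z) (exp_op (\<lambda>Z. - bracket (gen_J \<xi>) Z) X)"

definition coadjoint :: "gca_group \<Rightarrow> gca_dual \<Rightarrow> gca_dual" where
  "coadjoint g \<gamma> = (THE \<delta>. \<forall>X. pairing \<delta> X = pairing \<gamma> (Ad_inverse g X))"

end

theory Submission
  imports Defs
begin

text \<open>
  The operator \<open>-ad(P)\<close> squares to zero, and \<open>-ad(J\<^bsub>\<xi>\<^esub>)\<close> splits into a part that is nilpotent of
  order 3 and the rotation generator \<open>(f1, f2) \<mapsto> (-\<xi> f2, \<xi> f1)\<close>. The exponential of
  the latter is the rotation by the angle \<open>\<xi>\<close>; the only analytic point is that its series converges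
  with all derivatives. Integration by parts then moves all derivatives off \<open>X\<close> in
  \<open>\<langle>\<gamma>, g\<inverse> X g\<rangle>\<close>, and the element of the dual can be read off because the \<open>L\<^sup>2\<close> pairing is
  nondegenerate on smooth functions.
\<close>

section \<open>Convergence in the Frechet topology\<close>

lemma eval_periodic_nat: "eval f (x + real n * (2 * pi)) = eval f x"
proof (induction n)
  case (Suc n)
  have "eval f ((x + real n * (2 * pi)) + 2 * pi) = eval f (x + real n * (2 * pi))"
    by transfer simp
  with Suc show ?case by (simp add: algebra_simps)
qed simp

lemma eval_periodic_int: "eval f (x + real_of_int k * (2 * pi)) = eval f x"
proof (cases "k \<ge> 0")
  case True
  then show ?thesis using eval_periodic_nat[of f x "nat k"] by simp
next
  case False
  \<comment> \<open>A negative shift is undone by a positive one based at the already shifted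
    point.\<close>
  then show ?thesis
    using eval_periodic_nat[of f "x + real_of_int k * (2 * pi)" "nat (- k)"]
    by (simp add: algebra_simps)
qed

text \<open>Translating by floor(x / (2 pi)) periods lands in a compact interval, so bounds and
  vanishing need only be checked there.\<close>

lemma eval_fundamental_domain: "\<exists>t\<in>{0..2 * pi}. eval f x = eval f t"
proof -
  define k where "k = \<lfloor>x / (2 * pi)\<rfloor>"
  have "of_int k \<le> x / (2 * pi)" "x / (2 * pi) \<le> of_int k + 1"
    unfolding k_def by linarith+
  then have "of_int k * (2 * pi) \<le> x" "x \<le> (of_int k + 1) * (2 * pi)"
    by (simp_all only: pos_le_divide_eq pos_divide_le_eq pi_gt_zero zero_less_mult_iff
        zero_less_numeral simp_thms)
  then have "x + of_int (- k) * (2 * pi) \<in> {0..2 * pi}"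
    by (simp add: algebra_simps)
  then show ?thesis using eval_periodic_int[of f x "- k"] by metis
qed

lemma continuous_on_eval: "continuous_on A (eval f)"
  by (intro continuous_at_imp_continuous_on ballI DERIV_isCont[OF eval_DERIV])

lemma eval_bounded: "\<exists>B\<ge>0. \<forall>x. \<bar>eval f x\<bar> \<le> B"
proof -
  have "bounded (eval f ` {0..2 * pi})"
    by (intro compact_imp_bounded compact_continuous_image continuous_on_eval) simp
  then obtain B where B: "\<And>t. t \<in> {0..2 * pi} \<Longrightarrow> \<bar>eval f t\<bar> \<le> B"
    unfolding bounded_iff by (metis imageI real_norm_def)
  then have "\<bar>eval f x\<bar> \<le> B" for x
    using eval_fundamental_domain[of f x] by metis
  then show ?thesis by (meson abs_ge_zero order_trans)
qed

text \<open>This is the lowest seminorm of the Frechet topology; the higher ones arise by applying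
  it to iterated derivatives.\<close>

definition uniformly_null :: "(nat \<Rightarrow> circle_fun) \<Rightarrow> bool" where
  "uniformly_null F \<longleftrightarrow> (\<forall>e>0. \<forall>\<^sub>F N in sequentially. \<forall>x. \<bar>eval (F N) x\<bar> < e)"

lemma uniformly_null_add:
  assumes "uniformly_null F" "uniformly_null G"
  shows "uniformly_null (\<lambda>N. F N + G N)"
  unfolding uniformly_null_def
proof (intro allI impI)
  fix e :: real assume "e > 0"
  then have "\<forall>\<^sub>F N in sequentially. \<forall>x. \<bar>eval (F N) x\<bar> < e / 2"
    "\<forall>\<^sub>F N in sequentially. \<forall>x. \<bar>eval (G N) x\<bar> < e / 2"
    using assms unfolding uniformly_null_def by (meson half_gt_zero)+
  then show "\<forall>\<^sub>F N in sequentially. \<forall>x. \<bar>eval (F N + G N) x\<bar> < e"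
  proof eventually_elim
    case (elim N)
    show ?case
    proof
      fix x
      show "\<bar>eval (F N + G N) x\<bar> < e"
        using elim(1)[rule_format, of x] elim(2)[rule_format, of x] by simp
    qed
  qed
qed

lemma uniformly_null_Suc_iff: "uniformly_null (\<lambda>N. F (Suc N)) \<longleftrightarrow> uniformly_null F"
  unfolding uniformly_null_def
  using eventually_sequentially_Suc[of "\<lambda>N. \<forall>x. \<bar>eval (F N) x\<bar> < _"] by simp

lemma uniformly_null_le:
  assumes "b \<longlonglongrightarrow> 0" "\<And>N x. \<bar>eval (F N) x\<bar> \<le> b N"
  shows "uniformly_null F"
  unfolding uniformly_null_def
proof (intro allI impI)
  fix e :: real assume "e > 0"
  with assms(1) have "\<forall>\<^sub>F N in sequentially. b N < e" by (rule order_tendstoD)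
  then show "\<forall>\<^sub>F N in sequentially. \<forall>x. \<bar>eval (F N) x\<bar> < e"
    by eventually_elim (use assms(2) le_less_trans in blast)
qed

text \<open>A basic neighbourhood constrains only finitely many derivatives, so the eventual bounds
  for the separate orders can be intersected.\<close>

lemma tendsto_circle_funI:
  assumes "\<And>k. uniformly_null (\<lambda>N. (\<partial> ^^ k) (F N - f))"
  shows "F \<longlonglongrightarrow> f"
proof (rule topological_tendstoI)
  fix U assume "open U" "f \<in> U"
  then obtain n e where U: "e > 0"
    "\<And>g. (\<forall>k\<le>n. \<forall>x. \<bar>eval ((\<partial> ^^ k) (g - f)) x\<bar> < e) \<Longrightarrow> g \<in> U"
    unfolding open_circle_fun_def by blast
  have "\<forall>\<^sub>F N in sequentially. \<forall>k\<in>{..n}. \<forall>x. \<bar>eval ((\<partial> ^^ k) (F N - f)) x\<bar> < e"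
    using assms U(1) unfolding uniformly_null_def by (intro eventually_ball_finite) auto
  then show "\<forall>\<^sub>F N in sequentially. F N \<in> U"
    by eventually_elim (use U(2) in auto)
qed

section \<open>The trigonometric series\<close>

text \<open>The zero coefficients are kept, so \<open>N\<close> counts powers of \<xi> for cosine
  and sine alike and differentiation shifts both remainders equally.\<close>

definition cos_remainder :: "circle_fun \<Rightarrow> nat \<Rightarrow> circle_fun" where
  "cos_remainder \<xi> N = (\<Sum>n<N. cos_coeff n *\<^sub>R \<xi> ^ n) - cos_circle \<xi>"

definition sin_remainder :: "circle_fun \<Rightarrow> nat \<Rightarrow> circle_fun" where
  "sin_remainder \<xi> N = (\<Sum>n<N. sin_coeff n *\<^sub>R \<xi> ^ n) - sin_circle \<xi>"

lemma eval_cos_circle [simp]: "eval (cos_circle f) x = cos (eval f x)"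
  by transfer simp

lemma eval_sin_circle [simp]: "eval (sin_circle f) x = sin (eval f x)"
  by transfer simp

lemma eval_sum: "eval (\<Sum>i\<in>A. f i) x = (\<Sum>i\<in>A. eval (f i) x)"
  by (induction A rule: infinite_finite_induct) auto

lemma eval_power [simp]: "eval (f ^ n) x = eval f x ^ n"
  by (induction n) auto

lemma diff_circle_sum: "\<partial> (\<Sum>i\<in>A. f i) = (\<Sum>i\<in>A. \<partial> (f i))"
  by (induction A rule: infinite_finite_induct) (auto simp: diff_circle_add)

lemma diff_circle_funpow_add: "(\<partial> ^^ k) (f + g) = (\<partial> ^^ k) f + (\<partial> ^^ k) g"
  by (induction k) (auto simp: diff_circle_add)

lemma diff_circle_1 [simp]: "\<partial> 1 = 0"
  using diff_circle_mult[of 1 1] by simp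

lemma diff_circle_power_Suc: "\<partial> (f ^ Suc n) = real (Suc n) *\<^sub>R (f ^ n * \<partial> f)"
proof (induction n)
  case (Suc n)
  have "\<partial> (f ^ Suc (Suc n)) = \<partial> f * f ^ Suc n + f * \<partial> (f ^ Suc n)"
    by (simp only: power_Suc[of f "Suc n"] diff_circle_mult)
  also have "\<dots> = real (Suc (Suc n)) *\<^sub>R (f ^ Suc n * \<partial> f)"
    unfolding Suc by (simp add: scaleR_conv_of_real algebra_simps)
  finally show ?case .
qed simp

lemma diff_circle_cos: "\<partial> (cos_circle f) = - (sin_circle f * \<partial> f)"
  by (rule circle_fun_eqI, rule DERIV_unique[OF eval_DERIV])
     (auto simp: cos_circle.rep_eq intro!: derivative_eq_intros eval_DERIV)

lemma diff_circle_sin: "\<partial> (sin_circle f) = cos_circle f * \<partial> f"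
  by (rule circle_fun_eqI, rule DERIV_unique[OF eval_DERIV])
     (auto simp: sin_circle.rep_eq intro!: derivative_eq_intros eval_DERIV)

text \<open>The constant term disappears, and the factor n + 1 of the power rule cancels the
  denominator in the recursion for \<open>cos_coeff\<close>. Hence the truncation index drops by
  one.\<close>

lemma diff_cos_remainder_Suc: "\<partial> (cos_remainder \<xi> (Suc N)) = - (sin_remainder \<xi> N * \<partial> \<xi>)"
  unfolding cos_remainder_def sin_remainder_def sum.lessThan_Suc_shift
  by (simp add: diff_circle_add diff_circle_diff diff_circle_sum diff_circle_scaleR
        diff_circle_cos diff_circle_power_Suc cos_coeff_Suc sum_distrib_left sum_negf
        algebra_simps del: power_Suc of_nat_Suc)

lemma diff_sin_remainder_Suc: "\<partial> (sin_remainder \<xi> (Suc N)) = cos_remainder \<xi> N * \<partial> \<xi>"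
  unfolding cos_remainder_def sin_remainder_def sum.lessThan_Suc_shift
  by (simp add: diff_circle_add diff_circle_diff diff_circle_sum diff_circle_scaleR
        diff_circle_sin diff_circle_power_Suc sin_coeff_Suc sum_distrib_left
        algebra_simps del: power_Suc of_nat_Suc)

text \<open>Lagrange form of the Taylor remainder: every derivative of sine and cosine is bounded by
  1 at the intermediate point.\<close>

lemma trig_remainder_bound:
  assumes "\<And>x. \<bar>eval \<xi> x\<bar> \<le> B"
  shows "\<bar>eval (cos_remainder \<xi> N) x\<bar> \<le> B ^ N / fact N"
    and "\<bar>eval (sin_remainder \<xi> N) x\<bar> \<le> B ^ N / fact N"
proof -
  have bound: "\<bar>c / fact N * eval \<xi> x ^ N\<bar> \<le> B ^ N / fact N" if "\<bar>c\<bar> \<le> 1" for c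
    using mult_mono[OF that power_mono[OF assms[of x], of N]]
    by (simp add: abs_mult power_abs divide_right_mono)
  show "\<bar>eval (cos_remainder \<xi> N) x\<bar> \<le> B ^ N / fact N"
    using Maclaurin_cos_expansion[of "eval \<xi> x" N] bound[OF abs_cos_le_one]
    by (auto simp: cos_remainder_def eval_sum)
  show "\<bar>eval (sin_remainder \<xi> N) x\<bar> \<le> B ^ N / fact N"
    using Maclaurin_sin_expansion[of "eval \<xi> x" N] bound[OF abs_sin_le_one]
    by (auto simp: sin_remainder_def eval_sum)
qed

text \<open>
  The combination of both remainders with arbitrary coefficients makes the induction close:
  differentiating it gives combinations of the same shape, one of them with \<open>N\<close> shifted.
\<close>

lemma uniformly_null_trig_remainder:
  "uniformly_null (\<lambda>N. (\<partial> ^^ k) (g * cos_remainder \<xi> N + h * sin_remainder \<xi> N))"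
proof (induction k arbitrary: g h)
  case 0
  obtain B where B: "B \<ge> 0" "\<And>x. \<bar>eval \<xi> x\<bar> \<le> B" using eval_bounded by blast
  obtain G where G: "G \<ge> 0" "\<And>x. \<bar>eval g x\<bar> \<le> G" using eval_bounded by blast
  obtain H where H: "H \<ge> 0" "\<And>x. \<bar>eval h x\<bar> \<le> H" using eval_bounded by blast
  \<comment> \<open>The bound is a multiple of a term of the convergent exponential series.\<close>
  have "(\<lambda>N. (G + H) * (B ^ N / fact N)) \<longlonglongrightarrow> (G + H) * 0"
    using summable_LIMSEQ_zero[OF summable_exp[of B]]
    by (intro tendsto_mult tendsto_const) (simp add: field_simps)
  moreover have "\<bar>eval (g * cos_remainder \<xi> N + h * sin_remainder \<xi> N) x\<bar>
      \<le> (G + H) * (B ^ N / fact N)" for N x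
  proof -
    have "\<bar>eval g x * eval (cos_remainder \<xi> N) x\<bar> \<le> G * (B ^ N / fact N)"
      "\<bar>eval h x * eval (sin_remainder \<xi> N) x\<bar> \<le> H * (B ^ N / fact N)"
      unfolding abs_mult using G H trig_remainder_bound[OF B(2)]
      by (intro mult_mono; simp)+
    then show ?thesis
      unfolding eval_simps distrib_right by linarith
  qed
  ultimately show ?case by (auto intro: uniformly_null_le)
next
  case (Suc k)
  \<comment> \<open>Differentiating a coefficient keeps the index \<open>Suc N\<close>;
    differentiating a remainder swaps sine and cosine and lowers the index to
    \<open>N\<close>.\<close>
  have "(\<partial> ^^ Suc k) (g * cos_remainder \<xi> (Suc N) + h * sin_remainder \<xi> (Suc N)) =
      (\<partial> ^^ k) (\<partial> g * cos_remainder \<xi> (Suc N) + \<partial> h * sin_remainder \<xi> (Suc N))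
      + (\<partial> ^^ k) ((h * \<partial> \<xi>) * cos_remainder \<xi> N + (- (g * \<partial> \<xi>)) * sin_remainder \<xi> N)" for N
    unfolding diff_circle_funpow_add[symmetric] funpow_Suc_right o_apply
    by (simp add: diff_circle_add diff_circle_mult diff_cos_remainder_Suc diff_sin_remainder_Suc
        algebra_simps)
  moreover have "uniformly_null (\<lambda>N. (\<partial> ^^ k) (\<partial> g * cos_remainder \<xi> (Suc N)
      + \<partial> h * sin_remainder \<xi> (Suc N)))"
    using Suc[of "\<partial> g" "\<partial> h"] by (subst uniformly_null_Suc_iff)
  ultimately show ?case
    using uniformly_null_add Suc[of "h * \<partial> \<xi>" "- (g * \<partial> \<xi>)"]
    by (subst uniformly_null_Suc_iff[symmetric]) simp
qed

text \<open>The two free factors let one statement serve both rotated components, with (f1, -f2) and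
  (f2, f1).\<close>

lemma trig_series_sums:
  "(\<lambda>n. cos_coeff n *\<^sub>R (\<xi> ^ n * g) + sin_coeff n *\<^sub>R (\<xi> ^ n * h))
     sums (cos_circle \<xi> * g + sin_circle \<xi> * h)"
proof -
  have "(\<Sum>n<N. cos_coeff n *\<^sub>R (\<xi> ^ n * g) + sin_coeff n *\<^sub>R (\<xi> ^ n * h))
      - (cos_circle \<xi> * g + sin_circle \<xi> * h)
      = g * cos_remainder \<xi> N + h * sin_remainder \<xi> N" for N
    by (simp add: cos_remainder_def sin_remainder_def sum.distrib sum_distrib_left algebra_simps)
  then show ?thesis
    unfolding sums_def using uniformly_null_trig_remainder by (intro tendsto_circle_funI) simp
qed

section \<open>The adjoint action\<close>

lemma sums_Pair:
  assumes "f sums a" "g sums b"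
  shows "(\<lambda>n. (f n, g n)) sums (a, b)"
  using tendsto_Pair[OF assms[unfolded sums_def]] by (simp add: sums_def sum_prod)

lemma exp_op_eqI: "(\<lambda>n. (1 / fact n) *\<^sub>R (T ^^ n) X) sums Y \<Longrightarrow> exp_op T X = Y"
  unfolding exp_op_def by (rule sums_unique[symmetric])

text \<open>The second iterate at \<open>X\<close> is 0 and stays 0 under \<open>T\<close>, so the
  series stops after its linear term.\<close>

lemma exp_op_square_zero:
  assumes "T (T X) = 0" "T 0 = 0"
  shows "exp_op T X = X + T X"
proof (rule exp_op_eqI)
  have "(T ^^ n) X = 0" if "n \<notin> {..<2}" for n
  proof -
    have "(T ^^ (m + 2)) X = 0" for m
      using assms by (induction m) (auto simp: numeral_2_eq_2)
    then show ?thesis using that by (metis le_add_diff_inverse2 lessThan_iff not_less)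
  qed
  then have "(\<lambda>n. (1 / fact n) *\<^sub>R (T ^^ n) X) sums (\<Sum>n<2. (1 / fact n) *\<^sub>R (T ^^ n) X)"
    by (intro sums_finite) auto
  then show "(\<lambda>n. (1 / fact n) *\<^sub>R (T ^^ n) X) sums (X + T X)"
    by (simp add: numeral_2_eq_2)
qed

text \<open>Brackets with P read only the L and J components and land in the P components, so a
  second application gives 0.\<close>

lemma exp_ad_P:
  "exp_op (\<lambda>Z. - bracket (gen_P1 \<eta>1 + gen_P2 \<eta>2) Z) (f0, f1, f2, f3, \<alpha>, \<beta>) =
    (f0, f1 + f0 * \<partial> \<eta>1 - \<partial> f0 * \<eta>1 + f3 * \<eta>2, f2 + f0 * \<partial> \<eta>2 - \<partial> f0 * \<eta>2 - f3 * \<eta>1, f3, \<alpha>, \<beta>)"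
  by (subst exp_op_square_zero) (simp_all add: gen_defs zero_prod_def)

lemma integral_by_parts: "integral_circle (\<partial> f * g) = - integral_circle (f * \<partial> g)"
  using integral_circle_diff_circle[of "f * g"]
  by (simp add: diff_circle_mult integral_circle_add)

text \<open>Carrying 1 / n! along turns the rotation part into cosine and sine coefficients. The
  rest follows the chain from L to J to the centre, which ends at order 2; its last term is the
  source of the quadratic term in \<xi>'.\<close>

lemma ad_J_funpow:
  "(1 / fact n) *\<^sub>R ((\<lambda>Z. - bracket (gen_J \<xi>) Z) ^^ n) (f0, f1, f2, f3, \<alpha>, \<beta>) =
    (if n = 0 then f0 else 0,
     cos_coeff n *\<^sub>R (\<xi> ^ n * f1) + sin_coeff n *\<^sub>R (\<xi> ^ n * (- f2)),
     cos_coeff n *\<^sub>R (\<xi> ^ n * f2) + sin_coeff n *\<^sub>R (\<xi> ^ n * f1),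
     if n = 0 then f3 else if n = 1 then f0 * \<partial> \<xi> else 0,
     if n = 0 then \<alpha> else 0,
     if n = 0 then \<beta> else if n = 1 then integral_circle (\<partial> \<xi> * f3)
       else if n = 2 then integral_circle (f0 * (\<partial> \<xi>)\<^sup>2) / 2 else 0)"
  (is "_ *\<^sub>R (?T ^^ n) ?X = ?R n")
proof (induction n)
  case 0
  then show ?case by simp
next
  case (Suc n)
  \<comment> \<open>Scaling in the second slot, obtained from the first by antisymmetry, moves 1 /
    n! inside.\<close>
  have T: "?T (c *\<^sub>R Z) = c *\<^sub>R ?T Z" for c Z
    using bracket_scaleR_left[of c Z "gen_J \<xi>"] by (simp add: bracket_antisym[of "gen_J \<xi>"])
  have "(1 / fact (Suc n)) *\<^sub>R (?T ^^ Suc n) ?X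
      = (1 / real (Suc n)) *\<^sub>R ?T ((1 / fact n) *\<^sub>R (?T ^^ n) ?X)"
    unfolding T by simp
  also have "\<dots> = (1 / real (Suc n)) *\<^sub>R ?T (?R n)"
    unfolding Suc ..
  also have "\<dots> = ?R (Suc n)"
  proof -
    \<comment> \<open>These two integrals give the central component in the steps from order 1 to 2
      and from order 0 to 1.\<close>
    have "integral_circle (\<xi> * \<partial> (f0 * \<partial> \<xi>)) = - integral_circle (f0 * (\<partial> \<xi>)\<^sup>2)"
      using integral_by_parts[of \<xi> "f0 * \<partial> \<xi>"] by (simp add: power2_eq_square algebra_simps)
    moreover have "integral_circle (\<xi> * \<partial> f3) = - integral_circle (\<partial> \<xi> * f3)"
      using integral_by_parts[of \<xi> f3] by simp
    moreover have [simp]: "real (Suc 0) = 1" by simp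
    ultimately show ?thesis
      by (auto simp: gen_J_def cos_coeff_Suc sin_coeff_Suc algebra_simps simp del: of_nat_Suc)
  qed
  finally show ?case .
qed

text \<open>Convergence in the product is componentwise, and only the two P components are genuinely
  infinite series.\<close>

lemma exp_ad_J:
  "exp_op (\<lambda>Z. - bracket (gen_J \<xi>) Z) (f0, f1, f2, f3, \<alpha>, \<beta>) =
    (f0, cos_circle \<xi> * f1 - sin_circle \<xi> * f2, cos_circle \<xi> * f2 + sin_circle \<xi> * f1,
     f3 + f0 * \<partial> \<xi>, \<alpha>,
     \<beta> + integral_circle (\<partial> \<xi> * f3) + integral_circle (f0 * (\<partial> \<xi>)\<^sup>2) / 2)"
proof (rule exp_op_eqI, unfold ad_J_funpow, intro sums_Pair)
  show "(\<lambda>n. cos_coeff n *\<^sub>R (\<xi> ^ n * f1) + sin_coeff n *\<^sub>R (\<xi> ^ n * (- f2)))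
      sums (cos_circle \<xi> * f1 - sin_circle \<xi> * f2)"
    using trig_series_sums[of \<xi> f1 "- f2"] by simp
  show "(\<lambda>n. cos_coeff n *\<^sub>R (\<xi> ^ n * f2) + sin_coeff n *\<^sub>R (\<xi> ^ n * f1))
      sums (cos_circle \<xi> * f2 + sin_circle \<xi> * f1)"
    by (rule trig_series_sums)
  show "(\<lambda>n. if n = 0 then f0 else 0) sums f0" "(\<lambda>n. if n = 0 then \<alpha> else 0) sums \<alpha>"
    using sums_finite[of "{0}" "\<lambda>n. if n = 0 then f0 else 0"]
      sums_finite[of "{0}" "\<lambda>n. if n = 0 then \<alpha> else 0"] by auto
  show "(\<lambda>n. if n = 0 then f3 else if n = 1 then f0 * \<partial> \<xi> else 0) sums (f3 + f0 * \<partial> \<xi>)"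
    using sums_finite[of "{0, 1}" "\<lambda>n. if n = 0 then f3 else if n = 1 then f0 * \<partial> \<xi> else 0"] by auto
  show "(\<lambda>n. if n = 0 then \<beta> else if n = 1 then integral_circle (\<partial> \<xi> * f3)
       else if n = 2 then integral_circle (f0 * (\<partial> \<xi>)\<^sup>2) / 2 else 0)
      sums (\<beta> + integral_circle (\<partial> \<xi> * f3) + integral_circle (f0 * (\<partial> \<xi>)\<^sup>2) / 2)"
    using sums_finite[of "{0, 1, 2}" "\<lambda>n. if n = 0 then \<beta> else if n = 1 then integral_circle (\<partial> \<xi> * f3)
       else if n = 2 then integral_circle (f0 * (\<partial> \<xi>)\<^sup>2) / 2 else 0"] by (auto simp: add.assoc)
qed

section \<open>The coadjoint action\<close>

lemma integral_circle_diff: "integral_circle (f - g) = integral_circle f - integral_circle g"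
  using integral_circle_add[of f "- g"] by (simp add: integral_circle_uminus)

text \<open>A continuous nonnegative function with zero integral vanishes on the interval;
  periodicity covers all other points.\<close>

lemma integral_square_eq_0_imp:
  assumes "integral_circle (f * f) = 0"
  shows "f = 0"
proof (rule circle_fun_eqI)
  fix x
  obtain t where t: "t \<in> {0..2 * pi}" "eval f x = eval f t"
    using eval_fundamental_domain by blast
  have "(eval (f * f) has_integral 0) (cbox 0 (2 * pi))"
    using integrable_integral[OF eval_integrable[of "f * f" 0 "2 * pi"]] assms
    by (simp add: integral_circle.rep_eq)
  then have "eval (f * f) t = 0"
    by (rule has_integral_0_cbox_imp_0[OF continuous_on_eval, rotated])
       (use t pi_gt_zero in \<open>auto simp del: pi_gt_zero\<close>)
  then show "eval f x = eval 0 x" using t by simp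
qed

text \<open>Each function component is tested against the difference itself, which makes the
  integral of a square vanish. The central generators read off the scalars.\<close>

lemma pairing_nondegenerate:
  assumes "\<And>X. pairing \<delta> X = pairing \<delta>' X"
  shows "\<delta> = \<delta>'"
proof -
  obtain d0 d1 d2 d3 a b where d: "\<delta> = (d0, d1, d2, d3, a, b)" by (cases \<delta>)
  obtain e0 e1 e2 e3 a' b' where e: "\<delta>' = (e0, e1, e2, e3, a', b')" by (cases \<delta>')
  have eqI: "f = g" if "integral_circle (f * (f - g)) = integral_circle (g * (f - g))" for f g
  proof -
    have "integral_circle ((f - g) * (f - g)) = 0"
      using that integral_circle_diff[of "f * (f - g)" "g * (f - g)"]
      by (simp flip: left_diff_distrib)
    then show ?thesis using integral_square_eq_0_imp by force
  qed
  have "d0 = e0" "d1 = e1" "d2 = e2" "d3 = e3"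
    using assms[of "gen_L (d0 - e0)"] assms[of "gen_P1 (d1 - e1)"]
      assms[of "gen_P2 (d2 - e2)"] assms[of "gen_J (d3 - e3)"]
    by (intro eqI; simp add: d e gen_defs)+
  moreover have "a = a'" "b = b'"
    using assms[of gen_C1] assms[of gen_C2] by (simp_all add: d e gen_defs)
  ultimately show ?thesis by (simp add: d e)
qed

text \<open>Nondegeneracy supplies the uniqueness demanded by the definite description.\<close>

lemma coadjoint_eqI:
  assumes "\<And>X. pairing \<delta> X = pairing \<gamma> (Ad_inverse g X)"
  shows "coadjoint g \<gamma> = \<delta>"
  unfolding coadjoint_def using assms by (intro the_equality) (auto intro: pairing_nondegenerate)

theorem proposition4:
  fixes \<xi> \<eta>1 \<eta>2 \<gamma>0 \<gamma>1 \<gamma>2 \<gamma>3 :: circle_fun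
    and a b :: real
  shows "coadjoint (\<xi>, \<eta>1, \<eta>2) (\<gamma>0, \<gamma>1, \<gamma>2, \<gamma>3, a, b) =
    (\<gamma>0 + ((\<partial> \<gamma>1 * \<eta>1 + 2 * \<gamma>1 * \<partial> \<eta>1) + (\<partial> \<gamma>2 * \<eta>2 + 2 * \<gamma>2 * \<partial> \<eta>2))
       + (\<gamma>1 * \<eta>2 - \<gamma>2 * \<eta>1 + \<gamma>3) * \<partial> \<xi> + (b / 2) *\<^sub>R (\<partial> \<xi>)\<^sup>2,
     \<gamma>1 * cos_circle \<xi> + \<gamma>2 * sin_circle \<xi>,
     - \<gamma>1 * sin_circle \<xi> + \<gamma>2 * cos_circle \<xi>,
     \<gamma>1 * \<eta>2 - \<gamma>2 * \<eta>1 + \<gamma>3 + b *\<^sub>R \<partial> \<xi>,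
     a,
     b)"
proof (rule coadjoint_eqI)
  fix X :: gca
  obtain f0 f1 f2 f3 \<alpha> \<beta> where X: "X = (f0, f1, f2, f3, \<alpha>, \<beta>)" by (cases X)
  \<comment> \<open>Under the integral, -\<gamma> \<eta> f0' becomes (\<gamma>' \<eta> + \<gamma>
    \<eta>') f0; the term \<gamma> \<eta>' f0 from \<open>exp_ad_P\<close> raises this to \<gamma>'
    \<eta> + 2 \<gamma> \<eta>'.\<close>
  have parts: "integral_circle (\<eta> * (\<gamma> * \<partial> f0))
      = - integral_circle (\<eta> * (f0 * \<partial> \<gamma>)) - integral_circle (\<gamma> * (f0 * \<partial> \<eta>))" for \<gamma> \<eta>
    using integral_by_parts[of f0 "\<gamma> * \<eta>"]
    by (simp add: diff_circle_mult integral_circle_add algebra_simps)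
  \<comment> \<open>The 2 in the claim is a constant function and has to leave the integral as a
    scalar.\<close>
  have double: "integral_circle (\<gamma> * (f * (g * 2))) = 2 * integral_circle (\<gamma> * (f * g))" for \<gamma> f g
    using integral_circle_scaleR[of 2 "\<gamma> * (f * g)"]
    by (simp add: scaleR_conv_of_real mult_ac)
  show "pairing (\<gamma>0 + ((\<partial> \<gamma>1 * \<eta>1 + 2 * \<gamma>1 * \<partial> \<eta>1) + (\<partial> \<gamma>2 * \<eta>2 + 2 * \<gamma>2 * \<partial> \<eta>2))
       + (\<gamma>1 * \<eta>2 - \<gamma>2 * \<eta>1 + \<gamma>3) * \<partial> \<xi> + (b / 2) *\<^sub>R (\<partial> \<xi>)\<^sup>2,
     \<gamma>1 * cos_circle \<xi> + \<gamma>2 * sin_circle \<xi>,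
     - \<gamma>1 * sin_circle \<xi> + \<gamma>2 * cos_circle \<xi>,
     \<gamma>1 * \<eta>2 - \<gamma>2 * \<eta>1 + \<gamma>3 + b *\<^sub>R \<partial> \<xi>, a, b) X
    = pairing (\<gamma>0, \<gamma>1, \<gamma>2, \<gamma>3, a, b) (Ad_inverse (\<xi>, \<eta>1, \<eta>2) X)"
    \<comment> \<open>Feeding f3 + f0 \<xi>' from \<open>exp_ad_J\<close> into
      \<open>exp_ad_P\<close> produces the coefficient of \<xi>' that is free of \<open>b\<close>;
      the central shift, multiplied by \<open>b\<close>, produces the terms in
      \<open>b\<close>.\<close>
    unfolding X Ad_inverse.simps exp_ad_J exp_ad_P pairing.simps
    by (simp add: parts double integral_circle_add integral_circle_diff integral_circle_scaleR
        integral_circle_uminus algebra_simps)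
qed

end
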